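(* In the one-dimensional market $\mathcal{M}=\mathbb{R}$ with $q=0$, i.e. with aggregate prices $P_i\{x\}=P_i+(x-x_i)^2-\beta$, $\beta\ge0$, a pure strategy Nash equilibrium $\mathbf{P}^*=(P_i^* )_{i\in\mathcal{N}}\in[0,P_{upper}]^{\mathcal{N}}$ of the pricing game among the companies in $\mathcal{N}$ always exists.
   Context: Market: $\mathcal{M}=\mathbb{R}$; each point $x$ is a customer (uniform, unit density). $\mathcal{N}'$ is the (infinite) set of companies; company $k$ has fixed position $x_k\in\mathbb{R}$. Positions are distinct, every bounded interval contains finitely many companies, and there is $r<\infty$ such that every interval $(x_0-r,x_0+r)$ contains at least one company. For an arbitrarily chosen $B>0$, $\mathcal{N}=\{k\in\mathcal{N}' : x_k\in[-B/2,B/2]\}$, assumed nonempty (hence finite and nonempty). Only companies in $\mathcal{N}$ are players; every company $j\in\mathcal{N}'\setminus\mathcal{N}$ has a constant price $P_j\equiv P_{j0}\in[0,P_{upper}]$. Each player $i\in\mathcal{N}$ chooses a price $P_i\in[0,P_{upper}]$, where $P_{upper}$ is finite and sufficiently large (larger than some threshold depending on the market data). Aggregate price of company $i$ at customer $x$: $P_i\{x\}=P_i+(x-x_i)^2-\beta$. The set of owners of $x$ is $\mathcal{O}'(x,\mathbf{P})=\operatorname{argmin}_{k\in\mathcal{N}'}P_k\{x\}$. Market area: $\mathcal{S}_i=\{x:\mathcal{O}'(x,\mathbf{P})=\{i\}\}$, $S_i=|\mathcal{S}_i|$ (length). Payoff of $i$: $W_i(\mathbf{P})=P_i\cdot S_i$.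 A price vector $\mathbf{P}^*$ is a (pure strategy) Nash equilibrium if for each $i\in\mathcal{N}$, $P_i^*$ maximizes $P_i\mapsto W_i(P_i,P_{-i}^* )$ over $[0,P_{upper}]$. *)

theory Defs
  imports "HOL-Analysis.Analysis"
begin

text \<open>Companies are indexed by \<^term>\<open>K\<close>, with position \<^term>\<open>pos k\<close> on the real line.
  That \<^term>\<open>K\<close> is infinite follows from the last condition.\<close>

definition market :: "'k set \<Rightarrow> ('k \<Rightarrow> real) \<Rightarrow> bool" where
  "market K pos \<longleftrightarrow>
     inj_on pos K \<and>
     (\<forall>a b. finite {k \<in> K. pos k \<in> {a..b}}) \<and>
     (\<exists>r. \<forall>x. \<exists>k\<in>K. pos k \<in> {x - r<..<x + r})"

definition players :: "'k set \<Rightarrow> ('k \<Rightarrow> real) \<Rightarrow> real \<Rightarrow> 'k set" where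
  "players K pos B = {k \<in> K. pos k \<in> {- B / 2..B / 2}}"

definition aggregate_price ::
  "real \<Rightarrow> ('k \<Rightarrow> real) \<Rightarrow> ('k \<Rightarrow> real) \<Rightarrow> 'k \<Rightarrow> real \<Rightarrow> real" where
  "aggregate_price \<beta> pos P k x = P k + (x - pos k)\<^sup>2 - \<beta>"

definition owners ::
  "real \<Rightarrow> 'k set \<Rightarrow> ('k \<Rightarrow> real) \<Rightarrow> ('k \<Rightarrow> real) \<Rightarrow> real \<Rightarrow> 'k set" where
  "owners \<beta> K pos P x =
     {k. is_arg_min (\<lambda>k. aggregate_price \<beta> pos P k x) (\<lambda>k. k \<in> K) k}"

definition market_area ::
  "real \<Rightarrow> 'k set \<Rightarrow> ('k \<Rightarrow> real) \<Rightarrow> ('k \<Rightarrow> real) \<Rightarrow> 'k \<Rightarrow> real set" where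
  "market_area \<beta> K pos P i = {x. owners \<beta> K pos P x = {i}}"

text \<open>In a \<^const>\<open>market\<close> with bounded nonnegative prices, market areas are bounded intervals,
  so \<^const>\<open>measure\<close> returns their true length.\<close>

definition payoff ::
  "real \<Rightarrow> 'k set \<Rightarrow> ('k \<Rightarrow> real) \<Rightarrow> ('k \<Rightarrow> real) \<Rightarrow> 'k \<Rightarrow> real" where
  "payoff \<beta> K pos P i = P i * measure lborel (market_area \<beta> K pos P i)"

text \<open>A profile \<^term>\<open>P\<close> prices only the players \<^term>\<open>N\<close>; companies outside \<^term>\<open>N\<close> keep
  their constant prices \<^term>\<open>P0\<close>.\<close>

definition nash_equilibrium ::
  "real \<Rightarrow> 'k set \<Rightarrow> ('k \<Rightarrow> real) \<Rightarrow> 'k set \<Rightarrow> ('k \<Rightarrow> real) \<Rightarrow> real \<Rightarrow> ('k \<Rightarrow> real) \<Rightarrow> bool" where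
  "nash_equilibrium \<beta> K pos N P0 Pupper P \<longleftrightarrow>
     P \<in> N \<rightarrow>\<^sub>E {0..Pupper} \<and>
     (\<forall>i\<in>N. is_arg_max (\<lambda>p. payoff \<beta> K pos (override_on P0 (P(i := p)) N) i)
        (\<lambda>p. p \<in> {0..Pupper}) (P i))"

end

theory Submission
  imports Defs
begin

text \<open>A market area is an interval whose length is the positive part of a function of the prices that
  is Lipschitz continuous and, being a sum of infima of affine functions, concave. Hence the revenue
  of a player is continuous, and quasi-concave in its own price, so that best responses form an
  interval. Call a profile high (low) for a player if some best response is at most (at least) its
  current price. Both sets of profiles are closed and together they cover the cube of all profiles, so
  by the Poincare-Miranda theorem (obtained from Kuhn's combinatorial lemma, which is free of
  dimension types) some profile is both high and low for every player. As best responses form an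
  interval, that profile is an equilibrium, whatever the value of the price cap.\<close>

section \<open>Equilibria of quasi-concave games\<close>

lemma finite_pointwise_convergent_subseq:
  fixes X :: "nat \<Rightarrow> 'k \<Rightarrow> real"
  assumes "finite N" "\<And>m k. k \<in> N \<Longrightarrow> X m k \<in> {a..b}"
  shows "\<exists>P r. strict_mono (r :: nat \<Rightarrow> nat) \<and>
    (\<forall>k\<in>N. P k \<in> {a..b} \<and> (\<lambda>m. X (r m) k) \<longlonglongrightarrow> P k)"
  using assms
proof (induction N rule: finite_induct)
  case empty
  show ?case by (auto intro: exI[of _ id] simp: strict_mono_def)
next
  case (insert j N)
  obtain P and r :: "nat \<Rightarrow> nat" where r: "strict_mono r"
    and P: "\<And>k. k \<in> N \<Longrightarrow> P k \<in> {a..b}" "\<And>k. k \<in> N \<Longrightarrow> (\<lambda>m. X (r m) k) \<longlonglongrightarrow> P k"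
    using insert.IH insert.prems by (metis insertCI)
  have "seq_compact {a..b}" by (simp add: compact_imp_seq_compact)
  moreover have "\<forall>m. X (r m) j \<in> {a..b}" using insert.prems by auto
  ultimately obtain l and s :: "nat \<Rightarrow> nat" where l: "l \<in> {a..b}" and s: "strict_mono s"
    and lim: "((\<lambda>m. X (r m) j) \<circ> s) \<longlonglongrightarrow> l"
    unfolding seq_compact_def by metis
  have "(\<lambda>m. X ((r \<circ> s) m) k) \<longlonglongrightarrow> P k" if "k \<in> N" for k
    using LIMSEQ_subseq_LIMSEQ[OF P(2)[OF that] s] by (simp add: o_def)
  then have "\<forall>k\<in>insert j N. (P(j := l)) k \<in> {a..b} \<and> (\<lambda>m. X ((r \<circ> s) m) k) \<longlonglongrightarrow> (P(j := l)) k"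
    using l lim P(1) insert.hyps by (auto simp: o_def)
  then show ?case using strict_mono_o[OF r s] by blast
qed

text \<open>Divide each edge of the cube into \<open>p\<close> steps and label the grid points, in
  each coordinate, by which of the two sets they are known to lie in. Kuhn's lemma yields a cell on
  which every coordinate carries both labels. Its lowest corner is \<open>Q\<close>, and the
  differently labelled vertices are \<open>R\<close> and \<open>S\<close>, at most one step away
  from \<open>Q\<close> in each coordinate.\<close>

lemma poincare_miranda_approx:
  fixes N :: "'k set" and A B :: "'k \<Rightarrow> ('k \<Rightarrow> real) set" and a b :: real
  defines "C \<equiv> N \<rightarrow>\<^sub>E {a..b}"
  assumes N: "finite N" and ab: "a < b" and p: "0 < (p :: nat)"
    and cover: "\<And>i. i \<in> N \<Longrightarrow> C \<subseteq> A i \<union> B i"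
    and low: "\<And>i P. i \<in> N \<Longrightarrow> P \<in> C \<Longrightarrow> P i = a \<Longrightarrow> P \<in> A i"
    and high: "\<And>i P. i \<in> N \<Longrightarrow> P \<in> C \<Longrightarrow> P i = b \<Longrightarrow> P \<in> B i"
  shows "\<exists>Q\<in>C. \<forall>i\<in>N. (\<exists>R\<in>C \<inter> A i. \<forall>k\<in>N. \<bar>R k - Q k\<bar> \<le> (b - a) / p) \<and>
      (\<exists>S\<in>C \<inter> B i. \<forall>k\<in>N. \<bar>S k - Q k\<bar> \<le> (b - a) / p)"
proof -
  define n where "n = card N"
  obtain e where e: "bij_betw e {0..<n} N"
    using ex_bij_betw_nat_finite[OF N] unfolding n_def by auto
  define h where "h = inv_into {0..<n} e"
  have h: "h k < n" "e (h k) = k" if "k \<in> N" for k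
    using that e bij_betw_inv_into_right[OF e that] bij_betwE[OF bij_betw_inv_into[OF e]]
    unfolding h_def by auto
  have he: "e i \<in> N" "h (e i) = i" if "i < n" for i
    using that e bij_betw_inv_into_left[OF e, of i] bij_betwE[OF e] unfolding h_def by auto
  define pt where "pt x = (\<lambda>k\<in>N. a + (b - a) * real (x (h k)) / real p)" for x :: "nat \<Rightarrow> nat"
  have ptC: "pt x \<in> C" if "\<forall>i<n. x i \<le> p" for x
  proof -
    have "(b - a) * real (x (h k)) / real p \<le> b - a" if "k \<in> N" for k
      using \<open>\<forall>i<n. x i \<le> p\<close> h[OF that] ab p by (simp add: divide_le_eq)
    moreover have "0 \<le> (b - a) * real (x (h k)) / real p" for k
      using ab by simp
    ultimately show ?thesis unfolding C_def pt_def by fastforce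
  qed
  have pt_e: "pt x (e i) = a + (b - a) * real (x i) / real p" if "i < n" for x i
    using he[OF that] by (simp add: pt_def)
  \<comment> \<open>The condition \<open>x i < p\<close> forces label \<open>1\<close> on the upper
    face, as Kuhn's lemma requires. Label \<open>1\<close> therefore certifies membership in
    \<open>B (e i)\<close> for two reasons: the cover below that face, and \<open>high\<close> on
    it.\<close>
  define label where "label x i = (if x i < p \<and> pt x \<in> A (e i) then 0 else 1 :: nat)" for x i
  have lab1: "pt x \<in> B (e i)" if "\<forall>i<n. x i \<le> p" "i < n" "label x i \<noteq> 0" for x i
  proof (cases "x i < p")
    case True
    then show ?thesis using that cover[OF he(1)[OF that(2)]] ptC[OF that(1)]
      by (auto simp: label_def)
  next
    case False
    then have "x i = p" using that by (simp add: le_antisym)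
    then show ?thesis
      using high[OF he(1)[OF that(2)] ptC[OF that(1)]] pt_e[OF that(2), of x] p by simp
  qed
  obtain q where q: "\<forall>i<n. q i < p"
    and rs: "\<forall>i<n. \<exists>r s. (\<forall>j<n. q j \<le> r j \<and> r j \<le> q j + 1) \<and>
       (\<forall>j<n. q j \<le> s j \<and> s j \<le> q j + 1) \<and> label r i \<noteq> label s i"
  proof (rule kuhn_lemma[OF p, of n label])
    show "\<forall>x. (\<forall>i<n. x i \<le> p) \<longrightarrow> (\<forall>i<n. x i = 0 \<longrightarrow> label x i = 0)"
      using low[OF he(1) ptC] pt_e p by (auto simp: label_def)
  qed (auto simp: label_def)
  have close: "\<bar>pt x k - pt q k\<bar> \<le> (b - a) / p" if "\<forall>j<n. q j \<le> x j \<and> x j \<le> q j + 1" "k \<in> N" for x k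
  proof -
    have "pt x k - pt q k = (b - a) * (real (x (h k)) - real (q (h k))) / real p"
      using that(2) by (simp add: pt_def right_diff_distrib diff_divide_distrib)
    moreover have "\<bar>real (x (h k)) - real (q (h k))\<bar> \<le> 1"
      using that(1) h[OF that(2)] by force
    ultimately show ?thesis using ab p
      by (simp add: abs_mult divide_right_mono mult_left_le)
  qed
  have "(\<exists>R\<in>C \<inter> A i. \<forall>k\<in>N. \<bar>R k - pt q k\<bar> \<le> (b - a) / p) \<and>
      (\<exists>S\<in>C \<inter> B i. \<forall>k\<in>N. \<bar>S k - pt q k\<bar> \<le> (b - a) / p)" if i: "i \<in> N" for i
  proof -
    obtain r s where r: "\<forall>j<n. q j \<le> r j \<and> r j \<le> q j + 1"
      and s: "\<forall>j<n. q j \<le> s j \<and> s j \<le> q j + 1" and ne: "label r (h i) \<noteq> label s (h i)"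
      using rs h(1)[OF i] by blast
    have le: "\<forall>j<n. r j \<le> p" "\<forall>j<n. s j \<le> p" using r s q by (metis Suc_eq_plus1 Suc_leI le_trans)+
    show ?thesis
    proof (cases "label r (h i) = 0")
      case True
      then have "pt r \<in> C \<inter> A i" "pt s \<in> C \<inter> B i"
        using ptC le lab1[OF le(2) h(1)[OF i]] ne h(2)[OF i]
        by (auto simp: label_def split: if_splits)
      then show ?thesis using close r s by blast
    next
      case False
      then have "label s (h i) = 0" using ne by (auto simp: label_def split: if_splits)
      then have "pt s \<in> C \<inter> A i" "pt r \<in> C \<inter> B i"
        using ptC le lab1[OF le(1) h(1)[OF i] False] h(2)[OF i]
        by (auto simp: label_def split: if_splits)
      then show ?thesis using close r s by blast
    qed
  qed
  moreover have "pt q \<in> C" using ptC q by (simp add: less_imp_le)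
  ultimately show ?thesis by blast
qed

text \<open>As the grid is refined, the approximate points converge along a subsequence. The nearby
  points of \<open>A i\<close> and of \<open>B i\<close> have the same limit, which closedness puts
  into both sets.\<close>

lemma poincare_miranda:
  fixes N :: "'k set" and A B :: "'k \<Rightarrow> ('k \<Rightarrow> real) set" and a b :: real
  defines "C \<equiv> N \<rightarrow>\<^sub>E {a..b}"
  assumes N: "finite N" and ab: "a < b"
    and closed: "\<And>i. i \<in> N \<Longrightarrow> closed (A i)" "\<And>i. i \<in> N \<Longrightarrow> closed (B i)"
    and cover: "\<And>i. i \<in> N \<Longrightarrow> C \<subseteq> A i \<union> B i"
    and low: "\<And>i P. i \<in> N \<Longrightarrow> P \<in> C \<Longrightarrow> P i = a \<Longrightarrow> P \<in> A i"
    and high: "\<And>i P. i \<in> N \<Longrightarrow> P \<in> C \<Longrightarrow> P i = b \<Longrightarrow> P \<in> B i"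
  shows "\<exists>P\<in>C. \<forall>i\<in>N. P \<in> A i \<inter> B i"
proof -
  define \<epsilon> where "\<epsilon> m = (b - a) / real (Suc m)" for m
  have "\<forall>m. \<exists>Q\<in>C. \<forall>i\<in>N. (\<exists>R\<in>C \<inter> A i. \<forall>k\<in>N. \<bar>R k - Q k\<bar> \<le> \<epsilon> m) \<and>
      (\<exists>S\<in>C \<inter> B i. \<forall>k\<in>N. \<bar>S k - Q k\<bar> \<le> \<epsilon> m)"
    using cover low high unfolding C_def \<epsilon>_def
    by (intro allI poincare_miranda_approx[OF N ab]) auto
  then obtain Q where Q: "\<And>m. Q m \<in> C" and near:
    "\<And>m i. i \<in> N \<Longrightarrow> \<exists>R\<in>C \<inter> A i. \<forall>k\<in>N. \<bar>R k - Q m k\<bar> \<le> \<epsilon> m"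
    "\<And>m i. i \<in> N \<Longrightarrow> \<exists>S\<in>C \<inter> B i. \<forall>k\<in>N. \<bar>S k - Q m k\<bar> \<le> \<epsilon> m"
    by metis
  obtain P r where r: "strict_mono (r :: nat \<Rightarrow> nat)"
    and P: "\<And>k. k \<in> N \<Longrightarrow> P k \<in> {a..b}" "\<And>k. k \<in> N \<Longrightarrow> (\<lambda>m. Q (r m) k) \<longlonglongrightarrow> P k"
    using finite_pointwise_convergent_subseq[OF N, of Q a b] Q unfolding C_def by blast
  have "\<epsilon> \<longlonglongrightarrow> 0"
    unfolding \<epsilon>_def by (rule lim_const_over_n[THEN LIMSEQ_Suc])
  then have \<epsilon>: "(\<lambda>m. \<epsilon> (r m)) \<longlonglongrightarrow> 0"
    using LIMSEQ_subseq_LIMSEQ[OF _ r] by (simp add: o_def)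
  \<comment> \<open>Points of \<open>C\<close> are \<open>undefined\<close> outside
    \<open>N\<close>. The restriction gives the limit the same values there, so that convergence
    holds in every coordinate, as the product topology asks, and the limit lies in
    \<open>C\<close>.\<close>
  define P' where "P' = restrict P N"
  have mem: "P' \<in> D" if D: "closed D" and nearD: "\<And>m. \<exists>R\<in>C \<inter> D. \<forall>k\<in>N. \<bar>R k - Q m k\<bar> \<le> \<epsilon> m" for D
  proof -
    obtain R where R: "\<And>m. R m \<in> C \<inter> D" "\<And>m k. k \<in> N \<Longrightarrow> \<bar>R m k - Q m k\<bar> \<le> \<epsilon> m"
      using nearD by metis
    have "(\<lambda>m. R (r m) k) \<longlonglongrightarrow> P' k" for k
    proof (cases "k \<in> N")
      case True
      have "(\<lambda>m. R (r m) k - Q (r m) k) \<longlonglongrightarrow> 0"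
        by (rule Lim_null_comparison[OF _ \<epsilon>]) (simp add: R(2) True)
      from tendsto_add[OF this P(2)[OF True]] show ?thesis using True by (simp add: P'_def)
    next
      case False
      have "R m \<in> N \<rightarrow>\<^sub>E {a..b}" for m using R(1) unfolding C_def by blast
      then have "R m k = undefined" for m using False by (rule PiE_arb)
      then show ?thesis using False by (simp add: P'_def)
    qed
    then have "limitin (product_topology (\<lambda>_. euclidean) UNIV) (\<lambda>m. R (r m)) P' sequentially"
      by (simp add: limitin_componentwise)
    then have "(\<lambda>m. R (r m)) \<longlonglongrightarrow> P'"
      by (simp only: euclidean_product_topology limitin_canonical_iff)
    then show ?thesis using R(1) by (intro Lim_in_closed_set[OF D]) auto
  qed
  have "P' \<in> C" using P unfolding P'_def C_def by auto
  moreover have "P' \<in> A i \<inter> B i" if "i \<in> N" for i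
    using mem[OF closed(1)] mem[OF closed(2)] near that by blast
  ultimately show ?thesis by blast
qed

section \<open>Compactness of the set of profiles, and existence of equilibria\<close>

lemma Hausdorff_space_fun: "Hausdorff_space (euclidean :: ('a \<Rightarrow> 'b::metric_space) topology)"
proof -
  have "Hausdorff_space (product_topology (\<lambda>_ :: 'a. euclidean :: 'b topology) UNIV)"
    by (simp add: Hausdorff_space_product_topology)
  then show ?thesis by (simp only: euclidean_product_topology)
qed

text \<open>Meant for graphs of best responses, with the response as second component. The product
  topology over an arbitrary index type need not be metrizable, but it is Hausdorff, so a compact
  image is closed.\<close>

lemma closed_fst_image_compact:
  fixes G :: "(('a \<Rightarrow> 'b::metric_space) \<times> 'c::topological_space) set"
  assumes "compact G"
  shows "closed (fst ` G)"
proof -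
  have "compactin euclidean (fst ` G)"
    using assms by (simp add: compact_continuous_image continuous_on_fst continuous_on_id)
  then show ?thesis
    using compactin_imp_closedin[OF Hausdorff_space_fun] by simp
qed

lemma compact_PiE_real:
  fixes a b :: real
  shows "compact (N \<rightarrow>\<^sub>E {a..b})"
proof -
  \<comment> \<open>With the singleton \<open>{undefined}\<close> as factor outside
    \<open>N\<close>, the extensional product becomes a product over all indices, to which
    Tychonoff's theorem applies.\<close>
  have "N \<rightarrow>\<^sub>E {a..b} = (\<Pi>\<^sub>E k\<in>UNIV. if k \<in> N then {a..b} else {undefined})"
    by (auto simp: PiE_iff extensional_def split: if_splits)
  moreover have "compactin (product_topology (\<lambda>_. euclidean) UNIV) \<dots>"
    by (subst compactin_PiE) auto
  ultimately show ?thesis by (simp add: euclidean_product_topology)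
qed

theorem quasiconcave_game_equilibrium:
  fixes N :: "'k set" and u :: "'k \<Rightarrow> ('k \<Rightarrow> real) \<Rightarrow> real" and a b :: real
  defines "C \<equiv> N \<rightarrow>\<^sub>E {a..b}"
  assumes N: "finite N" and ab: "a < b"
    and cont: "\<And>i. i \<in> N \<Longrightarrow> continuous_on C (u i)"
    and quasi: "\<And>i P p q x. \<lbrakk>i \<in> N; P \<in> C; p \<in> {a..b}; q \<in> {a..b}; p \<le> x; x \<le> q\<rbrakk>
      \<Longrightarrow> min (u i (P(i := p))) (u i (P(i := q))) \<le> u i (P(i := x))"
  shows "\<exists>P\<in>C. \<forall>i\<in>N. \<forall>p\<in>{a..b}. u i (P(i := p)) \<le> u i P"
proof -
  define best where "best i P = {p \<in> {a..b}. \<forall>q\<in>{a..b}. u i (P(i := q)) \<le> u i (P(i := p))}" for i P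
  have updC: "P(i := p) \<in> C" if "P \<in> C" "i \<in> N" "p \<in> {a..b}" for P i p
    using that unfolding C_def by (auto simp: PiE_iff extensional_def)
  have cont_upd: "continuous_on S (\<lambda>z. u i ((f z)(i := g z)))"
    if "i \<in> N" "continuous_on S f" "continuous_on S g" "\<And>z. z \<in> S \<Longrightarrow> f z \<in> C \<and> g z \<in> {a..b}"
    for i f g and S :: "'z::topological_space set"
  proof (rule continuous_on_compose2[OF cont[OF that(1)]])
    have "continuous_on S (\<lambda>z. ((f z)(i := g z)) k)" for k
      using that by (cases "k = i") (auto intro: continuous_on_product_then_coordinatewise)
    then show "continuous_on S (\<lambda>z. (f z)(i := g z))"
      by (rule continuous_on_coordinatewise_then_product)
  qed (use updC that in auto)
  have best_ex: "\<exists>p. p \<in> best i P" if "i \<in> N" "P \<in> C" for i P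
    using continuous_attains_sup[of "{a..b}" "\<lambda>p. u i (P(i := p))"] ab
      cont_upd[OF that(1), of "{a..b}" "\<lambda>_. P" "\<lambda>p. p"] that(2)
    unfolding best_def by auto
  \<comment> \<open>The extra condition \<open>\<phi>\<close> will compare the response with the
    current price, in one direction for \<open>A\<close> and in the other for
    \<open>B\<close>.\<close>
  have closed: "closed (fst ` {z \<in> C \<times> {a..b}. snd z \<in> best i (fst z) \<and> \<phi> z})"
    if i: "i \<in> N" and \<phi>: "closed {z. \<phi> z}" for i \<phi>
  proof -
    let ?G = "{z \<in> C \<times> {a..b}. snd z \<in> best i (fst z)}"
    have cC: "compact (C \<times> {a..b})"
      unfolding C_def by (intro compact_Times compact_PiE_real compact_Icc)
    have "closed C"
      using compactin_imp_closedin[OF Hausdorff_space_fun] compact_PiE_real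
      unfolding C_def by fastforce
    then have clC: "closed (C \<times> {a..b})" by (simp add: closed_Times)
    \<comment> \<open>For a fixed alternative price \<open>q\<close>, optimality against
      \<open>q\<close> compares two continuous functions and is a closed condition. The best
      response graph intersects these conditions over all \<open>q\<close>.\<close>
    have "?G = (C \<times> {a..b}) \<inter> (\<Inter>q\<in>{a..b}. {z \<in> C \<times> {a..b}. u i ((fst z)(i := q)) \<le> u i ((fst z)(i := snd z))})"
      unfolding best_def by auto
    moreover have "closed {z \<in> C \<times> {a..b}. u i ((fst z)(i := q)) \<le> u i ((fst z)(i := snd z))}"
      if "q \<in> {a..b}" for q
      using that clC
      by (intro continuous_on_closed_Collect_le cont_upd[OF i] continuous_on_fst continuous_on_snd
          continuous_on_const continuous_on_id) auto
    ultimately have "closed ?G"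
      using clC by (metis (no_types, lifting) closed_INT closed_Int)
    then have "closed (?G \<inter> {z. \<phi> z})" using \<phi> by blast
    from compact_Int_closed[OF cC this]
    have "compact {z \<in> C \<times> {a..b}. snd z \<in> best i (fst z) \<and> \<phi> z}"
      by (rule back_subst[of compact]) auto
    then show ?thesis by (rule closed_fst_image_compact)
  qed
  \<comment> \<open>In the terms of the overview, \<open>A i\<close> collects the low profiles and
    \<open>B i\<close> the high ones.\<close>
  define A where "A i = fst ` {z \<in> C \<times> {a..b}. snd z \<in> best i (fst z) \<and> fst z i \<le> snd z}" for i
  define B where "B i = fst ` {z \<in> C \<times> {a..b}. snd z \<in> best i (fst z) \<and> snd z \<le> fst z i}" for i
  have coord: "continuous_on UNIV (\<lambda>z :: ('k \<Rightarrow> real) \<times> real. fst z i)" for i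
    by (rule continuous_on_product_then_coordinatewise[OF continuous_on_fst[OF continuous_on_id]])
  have inA: "P \<in> A i" if "P \<in> C" "p \<in> best i P" "P i \<le> p" for P i p
    using that unfolding A_def best_def by (auto simp: image_iff)
  have inB: "P \<in> B i" if "P \<in> C" "p \<in> best i P" "p \<le> P i" for P i p
    using that unfolding B_def best_def by (auto simp: image_iff)
  have "\<exists>P\<in>C. \<forall>i\<in>N. P \<in> A i \<inter> B i"
    unfolding C_def
  proof (rule poincare_miranda[OF N ab])
    fix i assume i: "i \<in> N"
    show "closed (A i)" "closed (B i)"
      unfolding A_def B_def
      by (intro closed[OF i] closed_Collect_le coord continuous_intros)+
    show "N \<rightarrow>\<^sub>E {a..b} \<subseteq> A i \<union> B i"
      using best_ex[OF i] inA[of _ _ i] inB[of _ _ i] unfolding C_def[symmetric]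
      by (metis UnCI linear subsetI)
    fix P assume P: "P \<in> N \<rightarrow>\<^sub>E {a..b}"
    then obtain p where p: "p \<in> best i P" using best_ex[OF i] unfolding C_def by blast
    then have "a \<le> p" "p \<le> b" unfolding best_def by auto
    \<comment> \<open>The boundary conditions are automatic: no best response lies below
      \<open>a\<close> or above \<open>b\<close>.\<close>
    then show "P i = a \<Longrightarrow> P \<in> A i" "P i = b \<Longrightarrow> P \<in> B i"
      using inA[OF _ p] inB[OF _ p] P unfolding C_def by auto
  qed
  then obtain P where P: "P \<in> C" "\<And>i. i \<in> N \<Longrightarrow> P \<in> A i \<inter> B i" by blast
  have "u i (P(i := x)) \<le> u i P" if i: "i \<in> N" and x: "x \<in> {a..b}" for i x
  proof -
    obtain p where p: "p \<in> best i P" "p \<le> P i" using P(2)[OF i] unfolding B_def by auto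
    obtain q where q: "q \<in> best i P" "P i \<le> q" using P(2)[OF i] unfolding A_def by auto
    \<comment> \<open>Both \<open>p\<close> and \<open>q\<close> attain the maximum, so the minimum
      on the left is that maximum, and \<open>P i\<close>, lying between them, attains it
      too.\<close>
    have "min (u i (P(i := p))) (u i (P(i := q))) \<le> u i (P(i := P i))"
      using p q P(1) i by (intro quasi) (auto simp: best_def)
    then show ?thesis using p(1) q(1) x unfolding best_def by fastforce
  qed
  then show ?thesis using P(1) by blast
qed

section \<open>Market areas\<close>

text \<open>Such a set differs from the open interval by at most two points, so it is measurable.
  This makes it irrelevant whether the infima that bound a market area are attained. For
  \<open>b < a\<close> the set is empty, hence the positive part.\<close>

lemma measure_lborel_between:
  fixes a b :: real
  assumes "{a<..<b} \<subseteq> A" "A \<subseteq> {a..b}"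
  shows "measure lborel A = max 0 (b - a)"
proof -
  have "A - {a<..<b} \<subseteq> {a, b}" using assms by force
  then have "finite (A - {a<..<b})" by (rule finite_subset) simp
  then have "A - {a<..<b} \<in> sets borel" by (simp add: borel_closed finite_imp_closed)
  moreover have "A = {a<..<b} \<union> (A - {a<..<b})" using assms by auto
  ultimately have A: "A \<in> sets lborel" by (metis sets_lborel sets.Un borel_open open_greaterThanLessThan)
  have fm: "{a<..<b} \<in> fmeasurable lborel" "{a..b} \<in> fmeasurable lborel"
    by (auto simp: fmeasurable_def emeasure_lborel_cbox_eq emeasure_lborel_box_eq simp flip: box_real)
  then have "A \<in> fmeasurable lborel"
    using A assms(2) by (metis fmeasurableI2)
  then have "measure lborel {a<..<b} \<le> measure lborel A" "measure lborel A \<le> measure lborel {a..b}"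
    using assms fm A by (intro measure_mono_fmeasurable; simp)+
  then show ?thesis using assms(2) by (cases "a \<le> b") (simp_all add: max_def)
qed

text \<open>The constant \<open>\<beta>\<close> enters all aggregate prices alike and cancels. The
  inequality is strict because a rival that ties with \<open>i\<close> would be an owner as
  well.\<close>

lemma market_area_iff:
  "x \<in> market_area \<beta> K pos P i \<longleftrightarrow>
    i \<in> K \<and> (\<forall>j\<in>K - {i}. P i + (x - pos i)\<^sup>2 < P j + (x - pos j)\<^sup>2)"
  (is "?L \<longleftrightarrow> ?R")
proof
  assume L: ?L
  then have own: "\<And>k. is_arg_min (\<lambda>k. aggregate_price \<beta> pos P k x) (\<lambda>k. k \<in> K) k \<longleftrightarrow> k = i"
    unfolding market_area_def owners_def by blast
  have "P i + (x - pos i)\<^sup>2 < P j + (x - pos j)\<^sup>2" if "j \<in> K - {i}" for j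
  proof (rule ccontr)
    assume "\<not> ?thesis"
    then have "aggregate_price \<beta> pos P j x \<le> aggregate_price \<beta> pos P i x"
      by (simp add: aggregate_price_def)
    then show False using own is_arg_min_antimono[of _ _ i j] that by blast
  qed
  then show ?R using own[of i] by (auto simp: is_arg_min_def)
next
  assume R: ?R
  then have "\<And>k. is_arg_min (\<lambda>k. aggregate_price \<beta> pos P k x) (\<lambda>k. k \<in> K) k \<longleftrightarrow> k = i"
    unfolding is_arg_min_def aggregate_price_def by (smt (verit) Diff_iff singletonD)
  then show ?L unfolding market_area_def owners_def by auto
qed

text \<open>The customers on the side of \<^term>\<open>J\<close> for which a company with price \<^term>\<open>p\<close> beats all
  competitors in \<^term>\<open>J\<close>, located at distances \<^term>\<open>d\<close>, are those up to distance
  \<^term>\<open>reach J d p P\<close>. It is negative if the company loses even the customer at its own position.\<close>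

definition reach :: "'k set \<Rightarrow> ('k \<Rightarrow> real) \<Rightarrow> real \<Rightarrow> ('k \<Rightarrow> real) \<Rightarrow> real" where
  "reach J d p P = (INF j\<in>J. (P j - p) / (2 * d j) + d j / 2)"

section \<open>Boundedness, Lipschitz continuity and concavity of the reach\<close>

lemma reach_lower:
  assumes "0 < \<delta>" "\<And>j. j \<in> J \<Longrightarrow> \<delta> \<le> d j" "\<And>j. j \<in> J \<Longrightarrow> 0 \<le> P j" "j \<in> J"
  shows "reach J d p P \<le> (P j - p) / (2 * d j) + d j / 2"
  unfolding reach_def
proof (rule cINF_lower)
  \<comment> \<open>There may be infinitely many rivals, so the infimum is a lower bound only once
    the terms are bounded below. The distance \<open>\<delta>\<close> and nonnegative prices give
    one bound for all of them.\<close>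
  have "- \<bar>p\<bar> / (2 * \<delta>) \<le> (P k - p) / (2 * d k) + d k / 2" if "k \<in> J" for k
  proof -
    have "- \<bar>p\<bar> / (2 * \<delta>) \<le> - \<bar>p\<bar> / (2 * d k)"
      using assms(1) assms(2)[OF that] by (simp add: divide_left_mono)
    also have "\<dots> \<le> (P k - p) / (2 * d k)"
      using assms(1) assms(2)[OF that] assms(3)[OF that] by (intro divide_right_mono) auto
    finally show ?thesis using assms(1) assms(2)[OF that] by simp
  qed
  then show "bdd_below ((\<lambda>j. (P j - p) / (2 * d j) + d j / 2) ` J)"
    by (intro bdd_belowI2)
qed (rule assms)

text \<open>The rival's price and the own price each move by at most \<open>e\<close>, so a term
  moves by at most \<open>2 * e / (2 * \<delta>)\<close>. This is uniform in the rival and so passes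
  to the infimum. The reverse estimate comes from exchanging the two profiles.\<close>

lemma reach_diff_le:
  assumes "0 < \<delta>" "\<And>j. j \<in> J \<Longrightarrow> \<delta> \<le> d j" "\<And>j. j \<in> J \<Longrightarrow> 0 \<le> P j" "J \<noteq> {}"
    and "\<And>j. j \<in> J \<Longrightarrow> \<bar>P j - Q j\<bar> \<le> e" "\<bar>p - q\<bar> \<le> e"
  shows "reach J d p P - reach J d q Q \<le> e / \<delta>"
proof -
  have "reach J d p P - e / \<delta> \<le> (Q j - q) / (2 * d j) + d j / 2" if "j \<in> J" for j
  proof -
    have "((P j - p) - (Q j - q)) / (2 * d j) \<le> 2 * e / (2 * d j)"
      using assms(1) assms(2,5)[OF that] assms(6) by (intro divide_right_mono) auto
    also have "\<dots> \<le> e / \<delta>"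
      using assms(1) assms(2)[OF that] assms(6) by (simp add: frac_le)
    finally show ?thesis
      using reach_lower[where d = d and P = P and p = p, OF assms(1-3) that] by (simp add: diff_divide_distrib)
  qed
  then have "reach J d p P - e / \<delta> \<le> reach J d q Q"
    unfolding reach_def[of J d q] using assms(4) by (intro cINF_greatest)
  then show ?thesis by simp
qed

lemma reach_concave:
  assumes "0 < \<delta>" "\<And>j. j \<in> J \<Longrightarrow> \<delta> \<le> d j" "\<And>j. j \<in> J \<Longrightarrow> 0 \<le> P j" "J \<noteq> {}"
    and "0 \<le> s" "0 \<le> t" "s + t = 1"
  shows "s * reach J d p P + t * reach J d q P \<le> reach J d (s * p + t * q) P"
proof -
  have "s * reach J d p P + t * reach J d q P \<le> (P j - (s * p + t * q)) / (2 * d j) + d j / 2"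
    if "j \<in> J" for j
  proof -
    have "s * reach J d p P + t * reach J d q P \<le>
        s * ((P j - p) / (2 * d j) + d j / 2) + t * ((P j - q) / (2 * d j) + d j / 2)"
      using reach_lower[where d = d and P = P, OF assms(1-3) that] assms(5,6)
      by (intro add_mono mult_left_mono)
    also have "\<dots> = ((s + t) * P j - (s * p + t * q)) / (2 * d j) + (s + t) * (d j / 2)"
      by (simp add: algebra_simps add_divide_distrib diff_divide_distrib)
    finally show ?thesis using assms(7) by simp
  qed
  then show ?thesis unfolding reach_def[of J d "s * p + t * q"] using assms(4) by (intro cINF_greatest)
qed

section \<open>Neighbouring companies, indifferent customers and demand\<close>

lemma market_neighbours:
  assumes "market K pos"
  shows "{j \<in> K. pos j > pos i} \<noteq> {}" "{j \<in> K. pos j < pos i} \<noteq> {}"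
proof -
  obtain r where r: "\<And>x. \<exists>k\<in>K. pos k \<in> {x - r<..<x + r}"
    using assms unfolding market_def by blast
  show "{j \<in> K. pos j > pos i} \<noteq> {}" "{j \<in> K. pos j < pos i} \<noteq> {}"
    \<comment> \<open>The interval of radius \<open>r\<close> around \<open>pos i + r\<close> lies
      strictly to the right of \<open>pos i\<close>, the one around \<open>pos i - r\<close>
      strictly to the left.\<close>
    using r[of "pos i + r"] r[of "pos i - r"] by auto
qed

text \<open>Only finitely many companies lie within distance 1 of \<open>pos i\<close>, and none
  shares its position, so the least of their distances and 1 works. This yields a Lipschitz constant
  valid for all rivals at once.\<close>

lemma market_gap:
  assumes "market K pos" "i \<in> K"
  shows "\<exists>\<delta>>0. \<forall>j\<in>K - {i}. \<delta> \<le> \<bar>pos j - pos i\<bar>"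
proof -
  define F where "F = {k \<in> K. pos k \<in> {pos i - 1..pos i + 1}} - {i}"
  have fin: "finite F" using assms unfolding market_def F_def by blast
  define \<delta> where "\<delta> = Min (insert 1 ((\<lambda>k. \<bar>pos k - pos i\<bar>) ` F))"
  have "pos k \<noteq> pos i" if "k \<in> F" for k
    using assms that unfolding market_def F_def inj_on_def by blast
  then have "\<delta> > 0" unfolding \<delta>_def using fin by auto
  moreover have "\<delta> \<le> \<bar>pos j - pos i\<bar>" if "j \<in> K - {i}" for j
  proof (cases "j \<in> F")
    case True
    then show ?thesis unfolding \<delta>_def using fin by auto
  next
    case False
    then have "1 \<le> \<bar>pos j - pos i\<bar>" using that unfolding F_def by auto
    moreover have "\<delta> \<le> 1" unfolding \<delta>_def using fin by auto
    ultimately show ?thesis by linarith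
  qed
  ultimately show ?thesis by blast
qed

text \<open>The terms quadratic in \<open>x\<close> cancel, leaving a single indifferent customer.
  The right-hand sides are exactly the terms of \<open>reach\<close>, with distance measured from
  \<open>y\<close> towards the rival at \<open>z\<close>.\<close>

lemma beats_iff:
  fixes x y z p q :: real
  shows "y < z \<Longrightarrow> p + (x - y)\<^sup>2 < q + (x - z)\<^sup>2 \<longleftrightarrow> x - y < (q - p) / (2 * (z - y)) + (z - y) / 2"
    and "z < y \<Longrightarrow> p + (x - y)\<^sup>2 < q + (x - z)\<^sup>2 \<longleftrightarrow> y - x < (q - p) / (2 * (y - z)) + (y - z) / 2"
proof -
  have *: "p + v\<^sup>2 < q + (d - v)\<^sup>2 \<longleftrightarrow> v < (q - p) / (2 * d) + d / 2" if "d > 0" for v d :: real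
  proof -
    have "(q - p) / (2 * d) + d / 2 = (q - p + d\<^sup>2) / (2 * d)"
      using that by (simp add: field_simps power2_eq_square)
    also have "v < \<dots> \<longleftrightarrow> v * (2 * d) < q - p + d\<^sup>2"
      using that by (simp add: pos_less_divide_eq)
    finally show ?thesis by (auto simp: power2_eq_square algebra_simps)
  qed
  show "y < z \<Longrightarrow> p + (x - y)\<^sup>2 < q + (x - z)\<^sup>2 \<longleftrightarrow> x - y < (q - p) / (2 * (z - y)) + (z - y) / 2"
    using *[of "z - y" "x - y"] by (simp add: power2_commute)
  show "z < y \<Longrightarrow> p + (x - y)\<^sup>2 < q + (x - z)\<^sup>2 \<longleftrightarrow> y - x < (q - p) / (2 * (y - z)) + (y - z) / 2"
    using *[of "y - z" "y - x"] by (simp add: power2_commute)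
qed

text \<open>A signed length of the market area. One summand may be negative while the area is
  nonempty, when the company loses the customer at its own position, so the positive part is taken
  of the sum only. The own price is a separate argument, which lets it vary against fixed
  rivals.\<close>

definition demand :: "'k set \<Rightarrow> ('k \<Rightarrow> real) \<Rightarrow> 'k \<Rightarrow> real \<Rightarrow> ('k \<Rightarrow> real) \<Rightarrow> real" where
  "demand K pos i p P = reach {j \<in> K. pos j > pos i} (\<lambda>j. pos j - pos i) p P
     + reach {j \<in> K. pos j < pos i} (\<lambda>j. pos i - pos j) p P"

context
  fixes K :: "'k set" and pos :: "'k \<Rightarrow> real" and i :: 'k and \<delta> :: real
  assumes market: "market K pos" and i: "i \<in> K"
    and \<delta>: "0 < \<delta>" and gap: "\<forall>j\<in>K - {i}. \<delta> \<le> \<bar>pos j - pos i\<bar>"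
begin

private lemma gaps:
  "j \<in> {j \<in> K. pos j > pos i} \<Longrightarrow> \<delta> \<le> pos j - pos i"
  "j \<in> {j \<in> K. pos j < pos i} \<Longrightarrow> \<delta> \<le> pos i - pos j"
  using gap by force+

text \<open>A customer is won if strictly within both reaches, and only if not beyond either. The
  area is thus squeezed between an open and a closed interval with the same ends.\<close>

lemma payoff_eq_demand:
  assumes "\<And>j. j \<in> K \<Longrightarrow> 0 \<le> P j"
  shows "payoff \<beta> K pos P i = P i * max 0 (demand K pos i (P i) P)"
proof -
  let ?R = "{j \<in> K. pos j > pos i}" and ?L = "{j \<in> K. pos j < pos i}"
  let ?r = "reach ?R (\<lambda>j. pos j - pos i) (P i) P" and ?l = "reach ?L (\<lambda>j. pos i - pos j) (P i) P"
  let ?A = "market_area \<beta> K pos P i"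
  have split: "K - {i} = ?R \<union> ?L"
    using market i unfolding market_def inj_on_def by (auto simp: not_less less_le)
  have area: "x \<in> ?A \<longleftrightarrow> (\<forall>j\<in>?R. x - pos i < (P j - P i) / (2 * (pos j - pos i)) + (pos j - pos i) / 2) \<and>
      (\<forall>j\<in>?L. pos i - x < (P j - P i) / (2 * (pos i - pos j)) + (pos i - pos j) / 2)" for x
    unfolding market_area_iff split using i beats_iff by (auto simp: ball_Un)
  have "{pos i - ?l<..<pos i + ?r} \<subseteq> ?A"
  proof
    fix x assume x: "x \<in> {pos i - ?l<..<pos i + ?r}"
    have "x - pos i < ?r" "pos i - x < ?l" using x by auto
    then show "x \<in> ?A" unfolding area
      using reach_lower[where P = P and p = "P i" and d = "\<lambda>j. pos j - pos i", OF \<delta> gaps(1)]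
        reach_lower[where P = P and p = "P i" and d = "\<lambda>j. pos i - pos j", OF \<delta> gaps(2)] assms
      by (force intro: less_le_trans)
  qed
  moreover have "?A \<subseteq> {pos i - ?l..pos i + ?r}"
  proof
    fix x assume x: "x \<in> ?A"
    have "x - pos i \<le> ?r"
      unfolding reach_def
      by (rule cINF_greatest[OF market_neighbours(1)[OF market]]) (use x area less_imp_le in blast)
    moreover have "pos i - x \<le> ?l"
      unfolding reach_def
      by (rule cINF_greatest[OF market_neighbours(2)[OF market]]) (use x area less_imp_le in blast)
    ultimately show "x \<in> {pos i - ?l..pos i + ?r}" by auto
  qed
  ultimately have "measure lborel ?A = max 0 ((pos i + ?r) - (pos i - ?l))"
    by (rule measure_lborel_between)
  then show ?thesis by (simp add: payoff_def demand_def add.commute)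
qed

lemma demand_diff_le:
  assumes "\<And>j. j \<in> K \<Longrightarrow> 0 \<le> P j" "\<And>j. j \<in> K \<Longrightarrow> \<bar>P j - Q j\<bar> \<le> e" "\<bar>p - q\<bar> \<le> e"
  shows "demand K pos i p P - demand K pos i q Q \<le> 2 * e / \<delta>"
proof -
  have "reach {j \<in> K. pos j > pos i} (\<lambda>j. pos j - pos i) p P
     - reach {j \<in> K. pos j > pos i} (\<lambda>j. pos j - pos i) q Q \<le> e / \<delta>"
    by (rule reach_diff_le[OF \<delta> gaps(1) _ market_neighbours(1)[OF market]]) (use assms in auto)
  moreover have "reach {j \<in> K. pos j < pos i} (\<lambda>j. pos i - pos j) p P
     - reach {j \<in> K. pos j < pos i} (\<lambda>j. pos i - pos j) q Q \<le> e / \<delta>"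
    by (rule reach_diff_le[OF \<delta> gaps(2) _ market_neighbours(2)[OF market]]) (use assms in auto)
  ultimately show ?thesis unfolding demand_def by simp
qed

lemma demand_concave:
  assumes "\<And>j. j \<in> K \<Longrightarrow> 0 \<le> P j" "0 \<le> s" "0 \<le> t" "s + t = 1"
  shows "s * demand K pos i p P + t * demand K pos i q P \<le> demand K pos i (s * p + t * q) P"
proof -
  have "s * reach {j \<in> K. pos j > pos i} (\<lambda>j. pos j - pos i) p P
     + t * reach {j \<in> K. pos j > pos i} (\<lambda>j. pos j - pos i) q P
     \<le> reach {j \<in> K. pos j > pos i} (\<lambda>j. pos j - pos i) (s * p + t * q) P"
    by (rule reach_concave[OF \<delta> gaps(1) _ market_neighbours(1)[OF market]]) (use assms in auto)
  moreover have "s * reach {j \<in> K. pos j < pos i} (\<lambda>j. pos i - pos j) p P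
     + t * reach {j \<in> K. pos j < pos i} (\<lambda>j. pos i - pos j) q P
     \<le> reach {j \<in> K. pos j < pos i} (\<lambda>j. pos i - pos j) (s * p + t * q) P"
    by (rule reach_concave[OF \<delta> gaps(2) _ market_neighbours(2)[OF market]]) (use assms in auto)
  ultimately show ?thesis unfolding demand_def by (simp add: algebra_simps)
qed

end

section \<open>Revenue as a function of the own price\<close>

lemma demand_cong:
  assumes "\<And>j. j \<noteq> i \<Longrightarrow> P j = Q j"
  shows "demand K pos i p P = demand K pos i p Q"
proof -
  have "P j = Q j" if "pos j \<noteq> pos i" for j using assms that by metis
  then show ?thesis
    unfolding demand_def reach_def
    by (intro arg_cong2[of _ _ _ _ "(+)"] arg_cong[of _ _ Inf] image_cong) auto
qed

text \<open>Here \<open>c\<close>, \<open>d\<close> and \<open>e\<close> stand for the demands at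
  prices \<open>p\<close>, \<open>q\<close> and their mixture. If the minimum \<open>v\<close> is
  positive, expand \<open>(s * p + t * q) * (s * c + t * d)\<close>: the diagonal terms are at least
  \<open>s * s * v\<close> and \<open>t * t * v\<close>, the mixed ones together at least
  \<open>2 * s * t * v\<close>, and the total is \<open>v\<close> because
  \<open>s + t = 1\<close>.\<close>

lemma revenue_quasiconcave:
  fixes p q s t c d e :: real
  assumes "0 \<le> p" "0 \<le> q" "0 \<le> s" "0 \<le> t" "s + t = 1" "s * c + t * d \<le> e"
  shows "min (p * max 0 c) (q * max 0 d) \<le> (s * p + t * q) * max 0 e"
proof -
  define v where "v = min (p * max 0 c) (q * max 0 d)"
  show ?thesis
  proof (cases "v \<le> 0")
    case True
    have "0 \<le> (s * p + t * q) * max 0 e" using assms by simp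
    then show ?thesis using True unfolding v_def by linarith
  next
    case False
    then have "p * max 0 c > 0" "q * max 0 d > 0" unfolding v_def by auto
    then have pos: "0 < p" "0 < c" "0 < q" "0 < d"
      using assms by (auto simp: zero_less_mult_iff)
    then have vpq: "v \<le> p * c" "v \<le> q * d" unfolding v_def by auto
    have "2 * v \<le> p * d + q * c" \<comment> \<open>AM-GM, as \<^term>\<open>v\<^sup>2 \<le> (p * d) * (q * c)\<close>\<close>
    proof -
      have "v\<^sup>2 \<le> (p * c) * (q * d)"
        using vpq False unfolding power2_eq_square by (intro mult_mono) auto
      then have "(2 * v)\<^sup>2 \<le> 4 * (p * d) * (q * c)" by (simp add: power2_eq_square algebra_simps)
      also have "\<dots> \<le> (p * d + q * c)\<^sup>2"
        using zero_le_power2[of "p * d - q * c"] by (simp add: power2_eq_square algebra_simps)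
      finally show ?thesis by (rule power2_le_imp_le) (use pos in simp)
    qed
    then have "s * s * v + t * t * v + s * t * (2 * v)
        \<le> s * s * (p * c) + t * t * (q * d) + s * t * (p * d + q * c)"
      using assms vpq by (intro add_mono mult_left_mono) auto
    also have "\<dots> = (s * p + t * q) * (s * c + t * d)" by (simp add: algebra_simps)
    also have "\<dots> \<le> (s * p + t * q) * max 0 e"
      using assms by (intro mult_left_mono) auto
    also have "s * s * v + t * t * v + s * t * (2 * v) = (s + t) * (s + t) * v"
      by (simp add: algebra_simps)
    finally show ?thesis using assms(5) by (simp add: v_def)
  qed
qed

section \<open>The pricing game as a quasi-concave game\<close>

theorem theorem3:
  fixes K :: "'k set" and pos :: "'k \<Rightarrow> real" and B \<beta> :: real
  assumes "market K pos"
    and "B > 0"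
    and "players K pos B \<noteq> {}"
    and "\<beta> \<ge> 0"
  shows "\<exists>T. \<forall>Pupper > T. \<forall>P0 \<in> (K - players K pos B) \<rightarrow> {0..Pupper}.
           \<exists>P. nash_equilibrium \<beta> K pos (players K pos B) P0 Pupper P"
\<comment> \<open>Every positive cap works, so \<open>0\<close> serves as threshold.\<close>
proof (rule exI[of _ 0], intro allI impI ballI)
  fix M :: real and P0 :: "'k \<Rightarrow> real"
  define N where "N = players K pos B"
  assume M: "0 < M" and P0: "P0 \<in> K - players K pos B \<rightarrow> {0..M}"
  let ?C = "N \<rightarrow>\<^sub>E {0..M}"
  define full where "full P = override_on P0 P N" for P
  have N: "finite N" "N \<subseteq> K"
    using assms(1) unfolding N_def players_def market_def by blast+
  have full_nonneg: "0 \<le> full P j" if "P \<in> ?C" "j \<in> K" for P j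
    using that P0 unfolding full_def N_def[symmetric] by (cases "j \<in> N") (auto simp: Pi_iff)
  define u where "u i P = payoff \<beta> K pos (full P) i" for i P
  have u: "continuous_on ?C (u i) \<and> (\<forall>P\<in>?C. \<forall>p\<in>{0..M}. \<forall>q\<in>{0..M}. \<forall>x\<in>{p..q}.
      min (u i (P(i := p))) (u i (P(i := q))) \<le> u i (P(i := x)))" if i: "i \<in> N" for i
  proof (intro conjI ballI)
    have iK: "i \<in> K" using i N by blast
    obtain \<delta> where \<delta>: "0 < \<delta>" and gap: "\<forall>j\<in>K - {i}. \<delta> \<le> \<bar>pos j - pos i\<bar>"
      using market_gap[OF assms(1) iK] by blast
    note pay = payoff_eq_demand[OF assms(1) iK \<delta> gap]
    have full_i: "full P i = P i" for P using i by (simp add: full_def)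
    have payC: "payoff \<beta> K pos (full P) i = P i * max 0 (demand K pos i (P i) (full P))" if "P \<in> ?C" for P
      using pay[of "full P", OF full_nonneg[OF that]] by (simp add: full_i)
    \<comment> \<open>As \<open>N\<close> is finite, this sum is continuous in the product topology.
      It bounds the price change of every company at once, since prices outside \<open>N\<close>
      stay fixed.\<close>
    define dist where "dist P Q = (\<Sum>k\<in>N. \<bar>P k - Q k\<bar>)" for P Q :: "'k \<Rightarrow> real"
    have le_dist: "\<bar>full P k - full Q k\<bar> \<le> dist P Q" for P Q k
    proof (cases "k \<in> N")
      case True
      then show ?thesis unfolding full_def dist_def
        using member_le_sum[OF True, of "\<lambda>k. \<bar>P k - Q k\<bar>"] N(1) by simp
    qed (simp add: full_def dist_def sum_nonneg)
    have lip: "demand K pos i (P i) (full P) - demand K pos i (Q i) (full Q) \<le> 2 * dist P Q / \<delta>"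
      if "P \<in> ?C" for P Q
      using le_dist[of P _ Q] le_dist[of P i Q] full_i full_nonneg[OF that]
      by (intro demand_diff_le[OF assms(1) iK \<delta> gap]) auto
    have dist_sym: "dist P Q = dist Q P" for P Q
      unfolding dist_def by (intro sum.cong abs_minus_commute refl)
    have coord: "continuous_on ?C (\<lambda>P. P k)" for k
      by (rule continuous_on_subset[OF continuous_on_product_coordinates subset_UNIV])
    have "continuous_on ?C (\<lambda>P. demand K pos i (P i) (full P))"
      unfolding continuous_on_def
    proof
      fix P assume P: "P \<in> ?C"
      have "((\<lambda>Q. 2 * dist Q P / \<delta>) \<longlongrightarrow> 2 * dist P P / \<delta>) (at P within ?C)"
        unfolding dist_def using coord P \<delta>
        by (intro tendsto_intros) (auto simp: continuous_on_def)
      then have lim0: "((\<lambda>Q. 2 * dist Q P / \<delta>) \<longlongrightarrow> 0) (at P within ?C)" by (simp add: dist_def)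
      have "norm (demand K pos i (Q i) (full Q) - demand K pos i (P i) (full P)) \<le> 2 * dist Q P / \<delta>"
        if "Q \<in> ?C" for Q
        \<comment> \<open>The one-sided Lipschitz bound is used in both directions to bound the
          absolute value.\<close>
        using lip[OF that, of P] lip[OF P, of Q] by (simp add: dist_sym[of P] abs_le_iff)
      then have "\<forall>\<^sub>F Q in at P within ?C.
          norm (demand K pos i (Q i) (full Q) - demand K pos i (P i) (full P)) \<le> 2 * dist Q P / \<delta>"
        by (auto simp: eventually_at_topological)
      from Lim_null_comparison[OF this lim0]
      show "((\<lambda>P. demand K pos i (P i) (full P)) \<longlongrightarrow> demand K pos i (P i) (full P)) (at P within ?C)"
        by (simp add: LIM_zero_iff)
    qed
    then have "continuous_on ?C (\<lambda>P. P i * max 0 (demand K pos i (P i) (full P)))"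
      by (intro continuous_on_mult coord continuous_on_max continuous_on_const)
    then show "continuous_on ?C (u i)"
      by (rule continuous_on_eq) (simp add: u_def payC)
    fix P p q x assume P: "P \<in> ?C" and p: "p \<in> {0..M}" and q: "q \<in> {0..M}" and x: "x \<in> {p..q}"
    have payU: "u i (P(i := y)) = y * max 0 (demand K pos i y (full P))"
      if "y \<in> {0..M}" for y
    proof -
      have "P(i := y) \<in> ?C" using P i that by (auto simp: PiE_iff extensional_def)
      moreover have "demand K pos i y (full (P(i := y))) = demand K pos i y (full P)"
        by (rule demand_cong) (simp add: full_def override_on_def)
      ultimately show ?thesis using payC by (simp add: u_def)
    qed
    have "x \<in> closed_segment p q" using x by (simp add: closed_segment_eq_real_ivl)
    then obtain t where t: "0 \<le> t" "t \<le> 1" "x = (1 - t) * p + t * q"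
      by (auto simp: closed_segment_def)
    have "min (p * max 0 (demand K pos i p (full P))) (q * max 0 (demand K pos i q (full P)))
        \<le> x * max 0 (demand K pos i x (full P))"
      unfolding t(3) using p q t(1,2)
      by (intro revenue_quasiconcave demand_concave[OF assms(1) iK \<delta> gap] full_nonneg P) auto
    then show "min (u i (P(i := p))) (u i (P(i := q))) \<le> u i (P(i := x))"
      using payU p q x by auto
  qed
  have "\<exists>P\<in>?C. \<forall>i\<in>N. \<forall>p\<in>{0..M}. u i (P(i := p)) \<le> u i P"
  proof (rule quasiconcave_game_equilibrium[OF N(1) M])
    fix i assume i: "i \<in> N"
    show "continuous_on ?C (u i)" using u[OF i] by (rule conjunct1)
    fix P p q x assume "P \<in> ?C" "p \<in> {0..M}" "q \<in> {0..M}" "p \<le> x" "x \<le> q"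
    then show "min (u i (P(i := p))) (u i (P(i := q))) \<le> u i (P(i := x))"
      using u[OF i] by (meson atLeastAtMost_iff)
  qed
  then obtain P where "P \<in> ?C" "\<forall>i\<in>N. \<forall>p\<in>{0..M}. u i (P(i := p)) \<le> u i P"
    by blast
  then have "nash_equilibrium \<beta> K pos N P0 M P"
    unfolding nash_equilibrium_def is_arg_max_def u_def full_def
    by (auto simp: PiE_iff not_less)
  then show "\<exists>P. nash_equilibrium \<beta> K pos (players K pos B) P0 M P"
    unfolding N_def by blast
qed

end
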